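(* Let $\mathbb{K}=(G,M,I)$ be a formal context with object set $G$, and let $\Pr$ be a probability measure on $G$ (defined on a $\sigma$-field containing all extents of $\mathbb{K}$). For $n\in\mathbb{N}$ let $\Pr^{(n)}$ be the empirical probability measure given by an i.i.d. sample of size $n$ drawn according to $\Pr$. If $\mathcal{ES}=\{\Phi(\{m\})\mid m\in M\}$ is a Glivenko-Cantelli class with respect to $\Pr$, then the empirical generalised Tukey depth $T^{(n)}$ is consistent (Property (P11)): $$\sup_{g\in G}\left|T^{(n)}(g,\mathbb{K})-T(g,\mathbb{K},\Pr)\right|\longrightarrow 0\quad\text{almost surely as } n\to\infty.$$
   Context: A formal context is a triple $\mathbb{K}=(G,M,I)$ with object set $G$, attribute set $M$ and a binary relation $I\subseteq G\times M$. For $A\subseteq G$ put $\Psi(A)=\{m\in M\mid \forall g\in A:(g,m)\in I\}$, and for $B\subseteq M$ put $\Phi(B)=\{g\in G\mid\forall m\in B:(g,m)\in I\}$ (so $\Psi(\emptyset)=M$, $\Phi(\emptyset)=G$). Then $\gamma=\Phi\circ\Psi$ is a closure operator on $2^G$, and the elements of $\gamma(2^G)$ are called the extents of $\mathbb{K}$. The generalised Tukey depth is $T(g,\mathbb{K},\Pr)=1-\sup_{m\in M\setminus\Psi(\{g\})}\Pr(\Phi(\{m\}))$, with the convention that a supremum over the empty index set equals $0$. Its empirical version is $T^{(n)}(g,\mathbb{K})=T(g,\mathbb{K},\Pr^{(n)})$, where for a sample $g_1,\dots,g_n$ the empirical measure is $\Pr^{(n)}(E)=\frac1n\#\{j\in\{1,\dots,n\}\mid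 g_j\in E\}$. A class $\mathcal{C}$ of measurable sets is a Glivenko-Cantelli class with respect to $\Pr$ if $\sup_{E\in\mathcal{C}}|\Pr^{(n)}(E)-\Pr(E)|\to0$ almost surely as $n\to\infty$ for the empirical measures of i.i.d. samples from $\Pr$. *)

theory Defs
  imports "HOL-Probability.Probability"
begin

record ('g, 'm) fcontext =
  objects :: "'g set"
  attributes :: "'m set"
  incidence :: "('g \<times> 'm) set"

definition formal_context :: "('g, 'm) fcontext \<Rightarrow> bool" where
  "formal_context K \<longleftrightarrow> incidence K \<subseteq> objects K \<times> attributes K"

definition common_attributes :: "('g, 'm) fcontext \<Rightarrow> 'g set \<Rightarrow> 'm set" where
  "common_attributes K A = {m \<in> attributes K. \<forall>g\<in>A. (g, m) \<in> incidence K}"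

definition common_objects :: "('g, 'm) fcontext \<Rightarrow> 'm set \<Rightarrow> 'g set" where
  "common_objects K B = {g \<in> objects K. \<forall>m\<in>B. (g, m) \<in> incidence K}"

definition extent_closure :: "('g, 'm) fcontext \<Rightarrow> 'g set \<Rightarrow> 'g set" where
  "extent_closure K = common_objects K \<circ> common_attributes K"

definition extents :: "('g, 'm) fcontext \<Rightarrow> 'g set set" where
  "extents K = extent_closure K ` Pow (objects K)"

definition attribute_extents :: "('g, 'm) fcontext \<Rightarrow> 'g set set" where
  "attribute_extents K = {common_objects K {m} | m. m \<in> attributes K}"

text \<open>On the reals, \<open>Sup {}\<close> is unspecified; here the empty supremum is \<open>0\<close>.\<close>

definition Sup0 :: "real set \<Rightarrow> real" where
  "Sup0 A = (if A = {} then 0 else Sup A)"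

text \<open>A probability enters the depth only through its values on sets, so it is passed as a set
  function: either \<open>measure P\<close> or an empirical measure.\<close>

definition tukey_depth :: "'g \<Rightarrow> ('g, 'm) fcontext \<Rightarrow> ('g set \<Rightarrow> real) \<Rightarrow> real" where
  "tukey_depth g K Pr =
     1 - Sup0 ((\<lambda>m. Pr (common_objects K {m})) ` (attributes K - common_attributes K {g}))"

text \<open>Samples are sequences indexed from \<open>1\<close>; the value \<open>x 0\<close> is never used.\<close>

definition empirical_measure :: "(nat \<Rightarrow> 'g) \<Rightarrow> nat \<Rightarrow> 'g set \<Rightarrow> real" where
  "empirical_measure x n E = real (card {j \<in> {1..n}. x j \<in> E}) / real n"

text \<open>The i.i.d. samples are realised as the coordinates of the infinite product space. The almost
  sure statement then carries over to i.i.d. samples on any probability space, since the joint law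
  of such a sample is this product measure.\<close>

definition glivenko_cantelli :: "'g measure \<Rightarrow> 'g set set \<Rightarrow> bool" where
  "glivenko_cantelli P C \<longleftrightarrow> C \<subseteq> sets P \<and>
     (AE x in (\<Pi>\<^sub>M i\<in>{1::nat..}. P).
        (\<lambda>n. Sup0 ((\<lambda>E. \<bar>empirical_measure x n E - measure P E\<bar>) ` C)) \<longlonglongrightarrow> 0)"

end

theory Submission
  imports Defs
begin

text \<open>
  The depth depends on the probability only through suprema of its values on attribute extents,
  and taking a supremum is \<open>1\<close>-Lipschitz for the uniform distance between the functions
  (\<open>abs_Sup0_diff_le\<close>). The difference of the empirical and the theoretical depth is therefore
  bounded, at every object and along every sample, by the deviation
  \<open>sup {\<bar>Pr\<^sup>(\<^sup>n\<^sup>)(E) - Pr(E)\<bar>}\<close> over all attribute extents \<open>E\<close>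
  (\<open>tukey_depth_diff_le\<close>). This bound is independent of the object, so the uniform distance of the
  depths is squeezed between \<open>0\<close> and that deviation, which vanishes almost surely by the
  Glivenko--Cantelli property.

  The Glivenko--Cantelli property speaks of the coordinates of the infinite product space, whereas
  the sample is an arbitrary i.i.d. sequence. The joint law of the sample is the product measure, so
  the null set pulls back along the sample map (\<open>AE_iid_sample\<close>).
\<close>

text \<open>By symmetry it suffices to bound one difference: \<open>f x \<le> h x + c \<le> sup h + c\<close> for every
  \<open>x\<close>. For empty \<open>A\<close> both values are \<open>0\<close>, which is why \<open>c\<close> has to be nonnegative.\<close>

lemma abs_Sup0_diff_le:
  fixes f h :: "'a \<Rightarrow> real"
  assumes bdd: "bdd_above (f ` A)" "bdd_above (h ` A)"
    and close: "\<And>x. x \<in> A \<Longrightarrow> \<bar>f x - h x\<bar> \<le> c" and "0 \<le> c"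
  shows "\<bar>Sup0 (f ` A) - Sup0 (h ` A)\<bar> \<le> c"
proof (cases "A = {}")
  case True
  then show ?thesis using \<open>0 \<le> c\<close> by (simp add: Sup0_def)
next
  case False
  have le: "(SUP x\<in>A. u x) \<le> (SUP x\<in>A. v x) + c"
    if "bdd_above (v ` A)" "\<And>x. x \<in> A \<Longrightarrow> \<bar>u x - v x\<bar> \<le> c" for u v :: "'a \<Rightarrow> real"
  proof (rule cSUP_least[OF False])
    fix x assume x: "x \<in> A"
    have "u x \<le> v x + c" using that(2)[OF x] by linarith
    also have "v x \<le> (SUP x\<in>A. v x)" by (rule cSUP_upper[OF x that(1)])
    finally show "u x \<le> (SUP x\<in>A. v x) + c" by simp
  qed
  have "(SUP x\<in>A. f x) \<le> (SUP x\<in>A. h x) + c" "(SUP x\<in>A. h x) \<le> (SUP x\<in>A. f x) + c"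
    using le[of h f] le[of f h] bdd close by (simp_all add: abs_minus_commute)
  then show ?thesis using False by (simp add: Sup0_def abs_le_iff)
qed

lemma Sup0_upper:
  assumes "bdd_above S" "x \<in> S"
  shows "x \<le> Sup0 S"
  using assms by (auto simp: Sup0_def intro: cSup_upper)

lemma Sup0_nonneg:
  assumes "bdd_above S" "\<And>x. x \<in> S \<Longrightarrow> 0 \<le> x"
  shows "0 \<le> Sup0 S"
proof (cases "S = {}")
  case False
  then obtain x where "x \<in> S" by blast
  then show ?thesis using assms Sup0_upper by force
qed (simp add: Sup0_def)

text \<open>The attributes missing at \<open>g\<close> only select a subfamily of the attribute extents, so the bound
  does not depend on \<open>g\<close>. Values in the unit interval keep all suprema finite.\<close>

lemma tukey_depth_diff_le:
  assumes "\<And>E. p E \<in> {0..1}" "\<And>E. q E \<in> {0..1}"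
  shows "\<bar>tukey_depth g K p - tukey_depth g K q\<bar>
    \<le> Sup0 ((\<lambda>E. \<bar>p E - q E\<bar>) ` attribute_extents K)" (is "_ \<le> Sup0 ?D")
proof -
  have bdd: "bdd_above ?D"
  proof (rule bdd_aboveI2)
    show "\<bar>p E - q E\<bar> \<le> 1" for E using assms(1)[of E] assms(2)[of E] by auto
  qed
  let ?A = "attributes K - common_attributes K {g}"
  have "\<bar>Sup0 ((\<lambda>m. p (common_objects K {m})) ` ?A)
       - Sup0 ((\<lambda>m. q (common_objects K {m})) ` ?A)\<bar> \<le> Sup0 ?D"
  proof (rule abs_Sup0_diff_le)
    show "0 \<le> Sup0 ?D" using bdd by (rule Sup0_nonneg) auto
    show "bdd_above ((\<lambda>m. p (common_objects K {m})) ` ?A)"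
         "bdd_above ((\<lambda>m. q (common_objects K {m})) ` ?A)"
      using assms by (auto intro!: bdd_aboveI2[where M = 1])
    show "\<bar>p (common_objects K {m}) - q (common_objects K {m})\<bar> \<le> Sup0 ?D" if "m \<in> ?A" for m
      using that by (intro Sup0_upper[OF bdd]) (auto simp: attribute_extents_def)
  qed
  then show ?thesis by (simp add: tukey_depth_def abs_minus_commute)
qed

lemma empirical_measure_in_unit_interval: "empirical_measure x n E \<in> {0..1}"
proof -
  have "card {j \<in> {1..n}. x j \<in> E} \<le> card {1..n}" by (intro card_mono) auto
  then show ?thesis by (cases "n = 0") (auto simp: empirical_measure_def divide_le_eq)
qed

lemma empirical_measure_cong:
  assumes "\<And>j. j \<ge> 1 \<Longrightarrow> x j = y j"
  shows "empirical_measure x n = empirical_measure y n"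
proof
  fix E
  have "{j \<in> {1..n}. x j \<in> E} = {j \<in> {1..n}. y j \<in> E}" using assms by auto
  then show "empirical_measure x n E = empirical_measure y n E" by (simp add: empirical_measure_def)
qed

text \<open>Independence makes the law of the whole sample the product of its marginals. The map into the
  product space is the sample restricted to \<open>I\<close>, since points of the product space take a fixed
  default value outside the index set.\<close>

lemma (in prob_space) AE_iid_sample:
  assumes "I \<noteq> {}" and indep: "indep_vars (\<lambda>_. P) X I"
    and law: "\<And>i. i \<in> I \<Longrightarrow> distr M P (X i) = P"
    and ae: "AE x in (\<Pi>\<^sub>M i\<in>I. P). Q x"
  shows "AE \<omega> in M. Q (\<lambda>i\<in>I. X i \<omega>)"
proof -
  have rv: "random_variable P (X i)" if "i \<in> I" for i
    using indep that by (simp add: indep_vars_def)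
  have "distr M (\<Pi>\<^sub>M i\<in>I. P) (\<lambda>\<omega>. \<lambda>i\<in>I. X i \<omega>) = (\<Pi>\<^sub>M i\<in>I. distr M P (X i))"
    using indep_vars_iff_distr_eq_PiM'[OF \<open>I \<noteq> {}\<close> rv] indep by simp
  also have "\<dots> = (\<Pi>\<^sub>M i\<in>I. P)"
    using law by (intro PiM_cong) auto
  finally have "AE x in distr M (\<Pi>\<^sub>M i\<in>I. P) (\<lambda>\<omega>. \<lambda>i\<in>I. X i \<omega>). Q x"
    using ae by (simp only:)
  then show ?thesis
    by (rule AE_distrD[rotated]) (use rv in measurable)
qed

theorem theorem8:
  fixes K :: "('g, 'm) fcontext"
    and P :: "'g measure"
    and \<Omega> :: "'w measure"
    and X :: "nat \<Rightarrow> 'w \<Rightarrow> 'g"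
  assumes "formal_context K"
    and "prob_space P"
    and "space P = objects K"
    and "extents K \<subseteq> sets P"
    and "prob_space \<Omega>"
    and "prob_space.indep_vars \<Omega> (\<lambda>_. P) X {1..}"
    and "\<And>i. i \<ge> 1 \<Longrightarrow> distr \<Omega> P (X i) = P"
    and "glivenko_cantelli P (attribute_extents K)"
  shows "AE \<omega> in \<Omega>.
    (\<lambda>n. SUP g\<in>objects K.
        \<bar>tukey_depth g K (empirical_measure (\<lambda>i. X i \<omega>) n) - tukey_depth g K (measure P)\<bar>)
      \<longlonglongrightarrow> 0"
proof -
  interpret P: prob_space P by fact
  interpret \<Omega>: prob_space \<Omega> by fact
  define D where "D x n =
    Sup0 ((\<lambda>E. \<bar>empirical_measure x n E - measure P E\<bar>) ` attribute_extents K)" for x n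
  \<comment> \<open>Without an object the supremum in the claim would be an unspecified real number.\<close>
  obtain g\<^sub>0 where g\<^sub>0: "g\<^sub>0 \<in> objects K"
    using P.not_empty assms(3) by blast
  have "AE \<omega> in \<Omega>. D (\<lambda>i\<in>{1..}. X i \<omega>) \<longlonglongrightarrow> 0"
    using assms(6-8) by (intro \<Omega>.AE_iid_sample) (auto simp: glivenko_cantelli_def D_def)
  then show ?thesis
  proof (rule AE_mp, intro AE_I2 impI)
    fix \<omega>
    let ?x = "\<lambda>i. X i \<omega>"
    let ?d = "\<lambda>n g. \<bar>tukey_depth g K (empirical_measure ?x n) - tukey_depth g K (measure P)\<bar>"
    assume "D (\<lambda>i\<in>{1..}. X i \<omega>) \<longlonglongrightarrow> 0"
    moreover have "D (\<lambda>i\<in>{1..}. X i \<omega>) = D ?x"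
      unfolding D_def by (intro ext) (simp cong: empirical_measure_cong)
    ultimately have lim: "D ?x \<longlonglongrightarrow> 0" by simp
    have d_le: "?d n g \<le> D ?x n" for n g
      unfolding D_def
      by (rule tukey_depth_diff_le[OF empirical_measure_in_unit_interval]) simp
    have "(SUP g\<in>objects K. ?d n g) \<le> D ?x n" for n
      using g\<^sub>0 d_le by (intro cSUP_least) auto
    moreover have "0 \<le> (SUP g\<in>objects K. ?d n g)" for n
      using d_le by (intro cSUP_upper2[OF _ g\<^sub>0] bdd_aboveI2) auto
    ultimately show "(\<lambda>n. SUP g\<in>objects K. ?d n g) \<longlonglongrightarrow> 0"
      by (intro tendsto_sandwich[OF _ _ tendsto_const lim] always_eventually allI)
  qed
qed

end
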